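(* Let $\{\mathbf{C}(N)\}_{N\ge 0}$ be the Half-Plane Half-Comb (HPHC) random walk on $\mathbb{Z}^2$ started at $(0,0)$, with local time $\Xi$ and truncated Green function $g$. Then for every real $x\ge 0$, $$\lim_{N\to\infty}\mathbf{P}\left(\frac{\Xi((0,0),N)}{g(N)}\ge x\right)=\lim_{N\to\infty}\mathbf{P}\left(\frac{\pi\,\Xi((0,0),N)}{2\log N}\ge x\right)=e^{-x}.$$
   Context: The HPHC random walk $\mathbf{C}(N)=(C_1(N),C_2(N))$, $N=0,1,2,\ldots$, is the time-homogeneous Markov chain on $\mathbb{Z}^2$ with one-step transition probabilities $$\mathbf{P}(\mathbf{C}(N+1)=(k\pm1,j)\mid \mathbf{C}(N)=(k,j))=\tfrac12-p_j \quad\text{(for each choice of sign)},$$ $$\mathbf{P}(\mathbf{C}(N+1)=(k,j\pm1)\mid \mathbf{C}(N)=(k,j))=p_j \quad\text{(for each choice of sign)},$$ where $p_j=\tfrac14$ for $j\ge 0$ and $p_j=\tfrac12$ for $j<0$. Its local time is $\Xi((k,j),N)=\sum_{r=0}^{N} I\{\mathbf{C}(r)=(k,j)\}$ for $(k,j)\in\mathbb{Z}^2$, where $I\{\cdot\}$ is the indicator. The truncated Green function is $g(N)=\sum_{k=0}^{\lfloor N/2\rfloor}\mathbf{P}(\mathbf{C}(2k)=(0,0))$. $\log$ is the natural logarithm. *)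

theory Defs
  imports "HOL-Probability.Probability"
begin

text \<open>A process \<open>C\<close> on a probability space \<open>M\<close> with a discrete state space is a
  time-homogeneous Markov chain with initial state \<open>z\<close> and one-step transition probabilities
  \<open>K x y\<close> (from \<open>x\<close> to \<open>y\<close>). The Markov property conditions on the whole past, and only on
  pasts of positive probability.\<close>

definition markov_chain_from ::
  "'a measure \<Rightarrow> ('s \<Rightarrow> 's \<Rightarrow> real) \<Rightarrow> 's \<Rightarrow> (nat \<Rightarrow> 'a \<Rightarrow> 's) \<Rightarrow> bool" where
  "markov_chain_from M K z C \<longleftrightarrow>
     prob_space M \<and>
     (\<forall>n. C n \<in> measurable M (count_space UNIV)) \<and>
     (AE \<omega> in M. C 0 \<omega> = z) \<and>
     (\<forall>n s y. \<P>(\<omega> in M. \<forall>i\<le>n. C i \<omega> = s i) > 0 \<longrightarrow>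
        \<P>(\<omega> in M. C (Suc n) \<omega> = y \<bar> \<forall>i\<le>n. C i \<omega> = s i) = K (s n) y)"

definition hphc_p :: "int \<Rightarrow> real" where
  "hphc_p j = (if j \<ge> 0 then 1/4 else 1/2)"

fun hphc_trans :: "int \<times> int \<Rightarrow> int \<times> int \<Rightarrow> real" where
  "hphc_trans (k, j) y =
     (if y = (k + 1, j) \<or> y = (k - 1, j) then 1/2 - hphc_p j
      else if y = (k, j + 1) \<or> y = (k, j - 1) then hphc_p j
      else 0)"

definition hphc_walk :: "'a measure \<Rightarrow> (nat \<Rightarrow> 'a \<Rightarrow> int \<times> int) \<Rightarrow> bool" where
  "hphc_walk M C \<longleftrightarrow> markov_chain_from M hphc_trans (0, 0) C"

definition local_time :: "(nat \<Rightarrow> 'a \<Rightarrow> 's) \<Rightarrow> 's \<Rightarrow> nat \<Rightarrow> 'a \<Rightarrow> real" where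
  "local_time C z N \<omega> = (\<Sum>r\<le>N. indicator {z} (C r \<omega>))"

definition truncated_green :: "'a measure \<Rightarrow> (nat \<Rightarrow> 'a \<Rightarrow> int \<times> int) \<Rightarrow> nat \<Rightarrow> real" where
  "truncated_green M C N = (\<Sum>k\<le>N div 2. \<P>(\<omega> in M. C (2 * k) \<omega> = (0, 0)))"

end

theory Submission
  imports Defs "HOL-Real_Asymp.Real_Asymp"
begin

text \<open>Let \<open>\<gamma>(N)\<close> be the probability of no return to the origin up to time \<open>N\<close>. If there
  are at least \<open>m\<close> returns up to time \<open>N\<close>, each of the first \<open>m\<close> excursions has length at most
  \<open>N\<close>, and conversely it suffices that each has length at most \<open>N / m\<close>. Hence the probability of
  at least \<open>m\<close> returns lies between \<open>(1 - \<gamma>(N / m))\<^sup>m\<close> and \<open>(1 - \<gamma>(N))\<^sup>m\<close>,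
  and the exponential limit follows as soon as
  \<open>\<gamma>(N) \<sim> 1 / (c ln N)\<close>, since then \<open>\<gamma>\<close> varies slowly. The generating functions of \<open>\<gamma>\<close> and of
  the return probabilities have product \<open>1 / (1 - z)\<close> (last exit decomposition), so by
  monotonicity of \<open>\<gamma>\<close> everything reduces to the logarithmic singularity of the latter at \<open>z = 1\<close>.
  For the HPHC walk, the Fourier transform in the horizontal coordinate turns the resolvent
  equation into a linear recurrence in the vertical one, which is solved by powers of the roots of
  two quadratic equations; this gives the generating function as an explicit integral, with
  \<open>c = 2 / \<pi>\<close>.\<close>

section \<open>Visits to a state by a Markov chain with finite steps\<close>

lemma summable_bounded_gf:
  fixes f :: "nat \<Rightarrow> real"
  assumes "\<And>n. 0 \<le> f n" "\<And>n. f n \<le> 1" "0 \<le> z" "z < 1"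
  shows "summable (\<lambda>n. f n * z ^ n)"
proof (rule summable_comparison_test)
  show "\<exists>N. \<forall>n\<ge>N. norm (f n * z ^ n) \<le> z ^ n"
    using assms by (auto simp: abs_mult intro!: mult_left_le_one_le)
  show "summable (\<lambda>n. z ^ n)"
    using assms by (simp add: summable_geometric)
qed

text \<open>Below \<open>k\<close> the weights are at most 1; from \<open>k\<close> on,
  \<open>B\<close> times a geometric series dominates. Applied with \<open>B = 1\<close> to the
  returns and with \<open>B = esc N\<close> to the escape probabilities.\<close>

lemma suminf_bounded_gf_tail:
  fixes f :: "nat \<Rightarrow> real"
  assumes f: "\<And>n. 0 \<le> f n" "\<And>n. f n \<le> 1" and z: "0 \<le> z" "z < 1"
    and B: "\<And>n. k \<le> n \<Longrightarrow> f n \<le> B"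
  shows "(\<Sum>n. f n * z ^ n) \<le> (\<Sum>n<k. f n) + B * z ^ k / (1 - z)"
proof -
  have s: "summable (\<lambda>n. f n * z ^ n)"
    by (rule summable_bounded_gf) (use f z in auto)
  have "(\<Sum>n. f n * z ^ n) = (\<Sum>n. f (n + k) * z ^ (n + k)) + (\<Sum>n<k. f n * z ^ n)"
    by (rule suminf_split_initial_segment[OF s])
  moreover have "(\<Sum>n<k. f n * z ^ n) \<le> (\<Sum>n<k. f n)"
    by (intro sum_mono mult_left_le power_le_one) (use f z in auto)
  moreover have "(\<Sum>n. f (n + k) * z ^ (n + k)) \<le> B * z ^ k / (1 - z)"
  proof (rule sums_le)
    show "f (n + k) * z ^ (n + k) \<le> B * z ^ k * z ^ n" for n
      using B[of "n + k"] z by (simp add: power_add mult_right_mono mult.assoc mult.commute[of "z ^ n"])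
    show "(\<lambda>n. f (n + k) * z ^ (n + k)) sums (\<Sum>n. f (n + k) * z ^ (n + k))"
      using summable_ignore_initial_segment[OF s] by (simp add: summable_sums)
    show "(\<lambda>n. B * z ^ k * z ^ n) sums (B * z ^ k / (1 - z))"
      using sums_mult[OF geometric_sums[of z], of "B * z ^ k"] z by simp
  qed
  ultimately show ?thesis by linarith
qed

locale finite_step_chain =
  fixes \<kappa> :: "'s :: countable \<Rightarrow> 's pmf" and a :: 's
  assumes finite_step [simp]: "finite (set_pmf (\<kappa> x))"
begin

text \<open>Paths are stored in reverse, the current state first.\<close>

primrec traj :: "nat \<Rightarrow> 's list pmf" where
  "traj 0 = return_pmf [a]"
| "traj (Suc n) = bind_pmf (traj n) (\<lambda>xs. map_pmf (\<lambda>y. y # xs) (\<kappa> (hd xs)))"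

lemma finite_set_traj [simp]: "finite (set_pmf (traj n))"
  by (induction n) auto

lemma integrable_step [simp]: "integrable (measure_pmf (\<kappa> x)) (f :: 's \<Rightarrow> real)"
  by (rule integrable_measure_pmf_finite) simp

lemma integrable_traj [simp]: "integrable (measure_pmf (traj n)) (f :: 's list \<Rightarrow> real)"
  by (rule integrable_measure_pmf_finite) simp

lemma expectation_traj_Suc:
  fixes f :: "'s list \<Rightarrow> real"
  shows "measure_pmf.expectation (traj (Suc n)) f =
    measure_pmf.expectation (traj n) (\<lambda>xs. measure_pmf.expectation (\<kappa> (hd xs)) (\<lambda>y. f (y # xs)))"
  by (simp add: pmf_expectation_bind[where A = "set_pmf (traj n)"]
      integral_measure_pmf[where A = "set_pmf (traj n)"])

text \<open>\<open>hits N n x\<close> is the probability that the chain started at \<open>x\<close> visits \<open>a\<close> at least \<open>n\<close> times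
  during the times \<open>1, \<dots>, N\<close>; a visit at time \<open>0\<close> does not count.\<close>

primrec hits :: "nat \<Rightarrow> nat \<Rightarrow> 's \<Rightarrow> real" where
  "hits 0 n x = of_bool (n = 0)"
| "hits (Suc N) n x = measure_pmf.expectation (\<kappa> x) (\<lambda>y. if y = a then hits N (n - 1) a else hits N n y)"

lemma hits_0 [simp]: "hits N 0 x = 1"
proof (induction N arbitrary: x)
  case (Suc N)
  show ?case by (simp add: Suc cong: if_cong)
qed simp

lemma hits_bounds: "0 \<le> hits N n x" "hits N n x \<le> 1"
proof -
  have "0 \<le> hits N n x \<and> hits N n x \<le> 1"
  proof (induction N arbitrary: n x)
    case (Suc N)
    show ?case
      using measure_pmf.integral_le_const[of "\<kappa> x" "\<lambda>y. if y = a then hits N (n - 1) a else hits N n y" 1]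
        measure_pmf.integral_ge_const[of "\<kappa> x" "\<lambda>y. if y = a then hits N (n - 1) a else hits N n y" 0]
      by (simp add: Suc)
  qed simp
  then show "0 \<le> hits N n x" "hits N n x \<le> 1" by auto
qed

lemma hits_mono_Suc: "hits N n x \<le> hits (Suc N) n x"
proof (induction N arbitrary: n x)
  case 0
  then show ?case by (cases "n = 0") (use hits_bounds[of "Suc 0" n x] hits_0[of "Suc 0" x] in \<open>auto simp del: hits.simps(2)\<close>)
next
  case (Suc N)
  have "measure_pmf.expectation (\<kappa> x) (\<lambda>y. if y = a then hits N (n - 1) a else hits N n y) \<le>
    measure_pmf.expectation (\<kappa> x) (\<lambda>y. if y = a then hits (Suc N) (n - 1) a else hits (Suc N) n y)"
    using Suc by (intro integral_mono integrable_step) (simp del: hits.simps(2))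
  then show ?case by (simp only: hits.simps(2))
qed

lemma hits_mono: "N \<le> N' \<Longrightarrow> hits N n x \<le> hits N' n x"
  using lift_Suc_mono_le[of "\<lambda>N. hits N n x"] hits_mono_Suc by blast

text \<open>After the first visit, each of the \<open>n\<close> further ones must follow its
  predecessor within at most \<open>L\<close> steps. The horizon \<open>L\<close> is kept apart from
  \<open>N\<close> so that it stays fixed while the induction shortens \<open>N\<close>.\<close>

lemma hits_le_power:
  assumes "N \<le> L"
  shows "hits N (Suc n) x \<le> hits N 1 x * hits L 1 a ^ n"
  using assms
proof (induction N arbitrary: n x)
  case (Suc N)
  have "(if y = a then hits N n a else hits N (Suc n) y) \<le>
    (if y = a then hits N 0 a else hits N 1 y) * hits L 1 a ^ n" for y
  proof (cases "y = a")
    case True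
    have "hits N n a \<le> hits L 1 a ^ n"
    proof (cases n)
      case (Suc k)
      have "hits N n a \<le> hits N 1 a * hits L 1 a ^ k"
        unfolding Suc using Suc.IH Suc.prems by simp
      also have "\<dots> \<le> hits L 1 a * hits L 1 a ^ k"
        using Suc.prems by (intro mult_right_mono hits_mono) (auto simp: hits_bounds)
      finally show ?thesis by (simp add: Suc)
    qed simp
    then show ?thesis using True by simp
  next
    case False
    then show ?thesis using Suc by simp
  qed
  then have "hits (Suc N) (Suc n) x \<le>
    measure_pmf.expectation (\<kappa> x) (\<lambda>y. (if y = a then hits N 0 a else hits N 1 y) * hits L 1 a ^ n)"
    unfolding hits.simps(2)
    by (intro integral_mono integrable_step) (metis (lifting) diff_Suc_1)
  then show ?case by (simp cong: if_cong)
qed simp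

text \<open>Markov property at the first visit: if it occurs within the first \<open>L\<close> of
  the \<open>N + L\<close> steps, at least \<open>N\<close> steps remain for the other
  \<open>n\<close> visits.\<close>

lemma hits_ge_mult: "hits L 1 x * hits N n a \<le> hits (N + L) (Suc n) x"
proof (induction L arbitrary: x)
  case 0
  show ?case by (simp add: hits_bounds)
next
  case (Suc L)
  have "hits (Suc L) 1 x * hits N n a =
    measure_pmf.expectation (\<kappa> x) (\<lambda>y. (if y = a then hits L 0 a else hits L 1 y) * hits N n a)"
    by (simp cong: if_cong)
  also have "\<dots> \<le> measure_pmf.expectation (\<kappa> x) (\<lambda>y. if y = a then hits (N + L) n a else hits (N + L) (Suc n) y)"
    by (intro integral_mono integrable_step) (use Suc in \<open>auto intro: hits_mono\<close>)
  finally show ?case by (simp cong: if_cong)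
qed

lemma hits_ge_power:
  assumes "L * n \<le> N"
  shows "hits L 1 a ^ n \<le> hits N n a"
proof -
  have "hits L 1 a ^ n \<le> hits (L * n) n a"
  proof (induction n)
    case (Suc n)
    have "hits L 1 a ^ Suc n \<le> hits L 1 a * hits (L * n) n a"
      using Suc by (auto intro!: mult_left_mono simp: hits_bounds)
    also have "\<dots> \<le> hits (L * Suc n) (Suc n) a"
      using hits_ge_mult[of L a "L * n" n] by (simp add: add.commute)
    finally show ?case .
  qed simp
  then show ?thesis using hits_mono[OF assms, of n a] by linarith
qed

lemma traj_Nil: "xs \<in> set_pmf (traj n) \<Longrightarrow> xs \<noteq> []"
  by (cases n) auto

text \<open>Links \<open>hits\<close>, which recurses on the first step, to \<open>traj\<close>,
  which grows at the last one. The shift \<open>n - 1\<close> discounts the visit at time 0;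
  truncated subtraction covers \<open>n = 0\<close>.\<close>

lemma prob_count_traj:
  "measure_pmf.prob (traj N) {xs. n \<le> count_list xs a} = hits N (n - 1) a"
proof -
  \<comment> \<open>Once \<open>m\<close> steps are known, the remaining \<open>N - m\<close> must
    supply the missing visits; \<open>e m\<close> averages the probability of this. It is constant
    in \<open>m \<le> N\<close>, and its two ends are the two sides of the claim.\<close>
  define e where "e = (\<lambda>m. measure_pmf.expectation (traj m) (\<lambda>xs. hits (N - m) (n - count_list xs a) (hd xs)))"
  have e_Suc: "e (Suc m) = e m" if "m < N" for m
  proof -
    define j where "j = N - Suc m"
    then have j: "N - m = Suc j" "N - Suc m = j" using that by auto
    show ?thesis
      unfolding e_def expectation_traj_Suc j
      by (intro Bochner_Integration.integral_cong refl)
        (auto intro!: Bochner_Integration.integral_cong simp: of_bool_def)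
  qed
  have "m \<le> N \<Longrightarrow> e m = e 0" for m
    by (induction m) (simp_all add: e_Suc)
  from this[of N] have "e N = e 0" by simp
  moreover have "e 0 = hits N (n - 1) a"
    by (simp add: e_def)
  moreover have "e N = measure_pmf.expectation (traj N) (indicator {xs. n \<le> count_list xs a})"
    unfolding e_def by (intro Bochner_Integration.integral_cong refl) (auto simp: indicator_def)
  ultimately show ?thesis by simp
qed

section \<open>Return and escape probabilities and their generating functions\<close>

definition ret :: "nat \<Rightarrow> real" where
  "ret n = measure_pmf.prob (traj n) {xs. hd xs = a}"

definition esc :: "nat \<Rightarrow> real" where
  "esc N = 1 - hits N 1 a"

lemma ret_eq: "ret n = measure_pmf.expectation (traj n) (\<lambda>xs. of_bool (hd xs = a))"
proof -
  have "(\<lambda>xs. of_bool (hd xs = a)) = (indicator {xs. hd xs = a} :: _ \<Rightarrow> real)"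
    by (auto simp: indicator_def fun_eq_iff)
  then show ?thesis by (simp add: ret_def)
qed

lemma ret_bounds: "0 \<le> ret n" "ret n \<le> 1"
  by (auto simp: ret_def)

lemma ret_0: "ret 0 = 1"
  by (simp add: ret_eq)

lemma esc_bounds: "0 \<le> esc N" "esc N \<le> 1"
  using hits_bounds by (auto simp: esc_def)

lemma esc_antimono: "N \<le> N' \<Longrightarrow> esc N' \<le> esc N"
  using hits_mono by (auto simp: esc_def)

text \<open>Partition by the time \<open>k\<close> of the last visit up to \<open>N\<close>, which
  exists because the chain starts in \<open>a\<close>.\<close>

lemma last_exit: "(\<Sum>k\<le>N. ret k * esc (N - k)) = 1"
proof -
  \<comment> \<open>\<open>e m\<close> is the probability of no visit at the times
    \<open>m + 1\<close> to \<open>N\<close>; passing to \<open>m + 1\<close> adds the paths whose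
    last visit is at time \<open>m + 1\<close>.\<close>
  define e where "e = (\<lambda>m. measure_pmf.expectation (traj m) (\<lambda>xs. 1 - hits (N - m) 1 (hd xs)))"
  have e_Suc: "e (Suc m) = e m + ret (Suc m) * esc (N - Suc m)" if "m < N" for m
  proof -
    define j where "j = N - Suc m"
    then have j: "N - m = Suc j" "N - Suc m = j" using that by auto
    have "e (Suc m) - ret (Suc m) * esc (N - Suc m) =
      measure_pmf.expectation (traj (Suc m)) (\<lambda>xs. 1 - hits j 1 (hd xs) - of_bool (hd xs = a) * esc j)"
      unfolding e_def ret_eq j by (simp del: traj.simps)
    also have "\<dots> = measure_pmf.expectation (traj (Suc m))
        (\<lambda>xs. 1 - (if hd xs = a then hits j (1 - 1) a else hits j 1 (hd xs)))"
      by (intro Bochner_Integration.integral_cong refl) (auto simp: esc_def)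
    also have "\<dots> = e m"
      unfolding e_def j expectation_traj_Suc by (simp cong: if_cong)
    finally show ?thesis by simp
  qed
  have "m \<le> N \<Longrightarrow> (\<Sum>k\<le>m. ret k * esc (N - k)) = e m" for m
  proof (induction m)
    case 0
    then show ?case by (simp add: e_def ret_0 esc_def)
  next
    case (Suc m)
    then show ?case using e_Suc[of m] by simp
  qed
  from this[of N] show ?thesis by (simp add: e_def)
qed

text \<open>Iterating the resolvent equation along the chain produces the partial sums of the series
  with remainder \<open>z ^ n * e n\<close>, which vanishes because \<open>h\<close> is bounded. To
  compute the generating function it thus suffices to exhibit one bounded solution.\<close>

lemma green_sums:
  assumes eq: "\<And>x. h x = of_bool (x = a) + z * measure_pmf.expectation (\<kappa> x) h"
    and bdd: "\<And>x. \<bar>h x\<bar> \<le> B" and z: "0 \<le> z" "z < 1"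
  shows "(\<lambda>n. ret n * z ^ n) sums h a"
proof -
  define e where "e = (\<lambda>n. measure_pmf.expectation (traj n) (\<lambda>xs. h (hd xs)))"
  have e_step: "e n = ret n + z * e (Suc n)" for n
    unfolding e_def expectation_traj_Suc ret_eq
    by (subst eq) simp
  have partial: "(\<Sum>k<n. ret k * z ^ k) = h a - z ^ n * e n" for n
  proof (induction n)
    case 0
    show ?case by (simp add: e_def)
  next
    case (Suc n)
    then show ?case using e_step[of n] by (simp add: algebra_simps)
  qed
  have "\<bar>e n\<bar> \<le> B" for n
  proof -
    have "\<bar>e n\<bar> \<le> measure_pmf.expectation (traj n) (\<lambda>xs. \<bar>h (hd xs)\<bar>)"
      unfolding e_def by (rule integral_abs_bound)
    also have "\<dots> \<le> B"
      by (intro measure_pmf.integral_le_const) (auto simp: bdd)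
    finally show ?thesis .
  qed
  then have "norm (z ^ n * e n) \<le> z ^ n * B" for n
    using z by (simp add: abs_mult mult_left_mono)
  then have "\<forall>\<^sub>F n in sequentially. norm (z ^ n * e n) \<le> z ^ n * B"
    by simp
  moreover have "(\<lambda>n. z ^ n * B) \<longlonglongrightarrow> 0"
    using z by (intro tendsto_mult_left_zero LIMSEQ_power_zero) auto
  ultimately have "(\<lambda>n. z ^ n * e n) \<longlonglongrightarrow> 0"
    by (rule Lim_null_comparison)
  then have "(\<lambda>n. h a - z ^ n * e n) \<longlonglongrightarrow> h a - 0"
    by (intro tendsto_intros)
  then show ?thesis by (simp add: sums_def partial)
qed

definition ret_gf :: "real \<Rightarrow> real" where
  "ret_gf z = (\<Sum>n. ret n * z ^ n)"

lemma ret_gf_ge_1: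
  assumes "0 \<le> z" "z < 1"
  shows "1 \<le> ret_gf z"
proof -
  have "(\<Sum>n\<in>{0}. ret n * z ^ n) \<le> ret_gf z"
    unfolding ret_gf_def
    by (intro sum_le_suminf summable_bounded_gf) (use assms in \<open>auto simp: ret_bounds\<close>)
  then show ?thesis by (simp add: ret_0)
qed

lemma ret_gf_le_partial_green:
  assumes "0 \<le> z" "z < 1"
  shows "ret_gf z \<le> (\<Sum>n\<le>N. ret n) + z ^ N / (1 - z)"
proof -
  have "ret_gf z \<le> (\<Sum>n<N. ret n) + 1 * z ^ N / (1 - z)"
    unfolding ret_gf_def by (rule suminf_bounded_gf_tail) (use assms in \<open>auto simp: ret_bounds\<close>)
  moreover have "(\<Sum>n<N. ret n) \<le> (\<Sum>n\<le>N. ret n)"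
    by (intro sum_mono2) (auto simp: ret_bounds)
  ultimately show ?thesis by simp
qed

text \<open>In the last exit identity each factor \<open>esc (N - n)\<close> is at least
  \<open>esc N\<close>.\<close>

lemma esc_partial_green_le_1: "esc N * (\<Sum>n\<le>N. ret n) \<le> 1"
proof -
  have "esc N * (\<Sum>n\<le>N. ret n) = (\<Sum>n\<le>N. ret n * esc N)"
    by (simp add: sum_distrib_left mult.commute)
  also have "\<dots> \<le> (\<Sum>n\<le>N. ret n * esc (N - n))"
    by (intro sum_mono mult_left_mono esc_antimono) (auto simp: ret_bounds)
  finally show ?thesis by (simp add: last_exit)
qed

lemma ret_gf_mult_esc_gf:
  assumes z: "0 \<le> z" "z < 1"
  shows "ret_gf z * (\<Sum>n. esc n * z ^ n) = 1 / (1 - z)"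
proof -
  have "summable (\<lambda>n. norm (ret n * z ^ n))" "summable (\<lambda>n. norm (esc n * z ^ n))"
    using summable_bounded_gf[of ret z] summable_bounded_gf[of esc z] z
    by (simp_all add: ret_bounds esc_bounds)
  then have "(\<lambda>k. \<Sum>i\<le>k. (ret i * z ^ i) * (esc (k - i) * z ^ (k - i))) sums
      (ret_gf z * (\<Sum>n. esc n * z ^ n))"
    unfolding ret_gf_def by (rule Cauchy_product_sums)
  moreover have "(\<Sum>i\<le>k. (ret i * z ^ i) * (esc (k - i) * z ^ (k - i))) = z ^ k" for k
  proof -
    have "(\<Sum>i\<le>k. (ret i * z ^ i) * (esc (k - i) * z ^ (k - i))) = (\<Sum>i\<le>k. z ^ k * (ret i * esc (k - i)))"
    proof (rule sum.cong)
      fix i assume "i \<in> {..k}"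
      then have "z ^ k = z ^ i * z ^ (k - i)" by (simp flip: power_add)
      then show "(ret i * z ^ i) * (esc (k - i) * z ^ (k - i)) = z ^ k * (ret i * esc (k - i))" by simp
    qed simp
    then show ?thesis by (simp add: last_exit flip: sum_distrib_left)
  qed
  ultimately show ?thesis
    using geometric_sums[of z] z by (simp add: sums_iff)
qed

text \<open>By the product formula, \<open>1 / ret_gf z\<close> is \<open>1 - z\<close> times the
  series of \<open>esc\<close>, whose coefficients are at most 1 before \<open>N\<close> and at most
  \<open>esc N\<close> from there on.\<close>

lemma inverse_ret_gf_le_esc:
  assumes z: "0 \<le> z" "z < 1"
  shows "1 / ret_gf z \<le> (1 - z) * N + esc N"
proof -
  have "(\<Sum>n. esc n * z ^ n) \<le> (\<Sum>n<N. esc n) + esc N * z ^ N / (1 - z)"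
    by (rule suminf_bounded_gf_tail) (use z in \<open>auto simp: esc_bounds esc_antimono\<close>)
  also have "(\<Sum>n<N. esc n) \<le> N"
    using sum_mono[of "{..<N}" esc "\<lambda>_. 1"] by (simp add: esc_bounds)
  also have "esc N * z ^ N / (1 - z) \<le> esc N / (1 - z)"
    using z by (intro divide_right_mono mult_left_le power_le_one) (auto simp: esc_bounds)
  finally have "(1 - z) * (\<Sum>n. esc n * z ^ n) \<le> (1 - z) * (N + esc N / (1 - z))"
    using z by (intro mult_left_mono) auto
  also have "\<dots> = (1 - z) * N + esc N"
    using z by (simp add: field_simps)
  also have "(1 - z) * (\<Sum>n. esc n * z ^ n) = 1 / ret_gf z"
    using ret_gf_mult_esc_gf[OF z] ret_gf_ge_1[OF z] z by (simp add: field_simps)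
  finally show ?thesis .
qed

end

section \<open>Logarithmic Green functions\<close>

locale log_green_chain = finite_step_chain +
  fixes c :: real
  assumes c_pos: "c > 0"
    and log_green: "((\<lambda>e. ret_gf (1 - e) / ln (1 / e)) \<longlongrightarrow> c) (at_right 0)"
begin

text \<open>As the singularity is logarithmic, \<open>e N\<close> may deviate from
  \<open>1 / N\<close> by powers of \<open>ln N\<close> without changing the limit. This freedom is
  used to make error terms negligible.\<close>

lemma ret_gf_along:
  fixes e :: "nat \<Rightarrow> real"
  assumes e: "filterlim e (at_right 0) sequentially"
    and l: "(\<lambda>N. ln (1 / e N) / ln N) \<longlonglongrightarrow> 1"
  shows "(\<lambda>N. ret_gf (1 - e N) / ln N) \<longlonglongrightarrow> c"
proof -
  have "(\<lambda>N. ret_gf (1 - e N) / ln (1 / e N) * (ln (1 / e N) / ln N)) \<longlonglongrightarrow> c * 1"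
    by (intro tendsto_mult l filterlim_compose[OF log_green e])
  moreover have "\<forall>\<^sub>F N in sequentially. ln (1 / e N) / ln N > 0"
    using order_tendstoD(1)[OF l, of 0] by simp
  then have "\<forall>\<^sub>F N in sequentially. ret_gf (1 - e N) / ln (1 / e N) * (ln (1 / e N) / ln N) = ret_gf (1 - e N) / ln N"
    by eventually_elim auto
  ultimately show ?thesis
    using Lim_transform_eventually by fastforce
qed

text \<open>This one-sided estimate yields the upper bound in \<open>esc_asymp\<close>; the matching
  upper estimate of the partial sums is then drawn from \<open>esc_asymp\<close>.\<close>

lemma partial_green_lower:
  "\<exists>l. l \<longlonglongrightarrow> c \<and> (\<forall>\<^sub>F N in sequentially. l N \<le> (\<Sum>n\<le>N. ret n) / ln N)"
proof -
  \<comment> \<open>\<open>ln (1 / e N) \<sim> ln N\<close>, while \<open>(1 - e N) ^ N \<le> N powr -2\<close> makes the tail beyond \<open>N\<close> negligible\<close>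
  define e where "e = (\<lambda>N::nat. 2 * ln N / N)"
  have "(\<lambda>N. ret_gf (1 - e N) / ln N) \<longlonglongrightarrow> c"
    by (rule ret_gf_along; unfold e_def; real_asymp)
  moreover have "(\<lambda>N::nat. 1 / (N * (2 * ln N) * ln N)) \<longlonglongrightarrow> 0"
    by real_asymp
  ultimately have "(\<lambda>N. ret_gf (1 - e N) / ln N - 1 / (N * (2 * ln N) * ln N)) \<longlonglongrightarrow> c - 0"
    by (rule tendsto_diff)
  moreover have "\<forall>\<^sub>F N::nat in sequentially. 0 < e N" "\<forall>\<^sub>F N::nat in sequentially. e N < 1"
    "\<forall>\<^sub>F N::nat in sequentially. N > 1"
    unfolding e_def by real_asymp+
  then have "\<forall>\<^sub>F N in sequentially.
      ret_gf (1 - e N) / ln N - 1 / (N * (2 * ln N) * ln N) \<le> (\<Sum>n\<le>N. ret n) / ln N"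
  proof eventually_elim
    case (elim N)
    have lnN: "ln N > 0" using elim by simp
    have "(1 - e N) ^ N \<le> exp (- e N) ^ N"
      using elim exp_ge_add_one_self[of "- e N"] by (intro power_mono) auto
    also have "\<dots> = exp (- 2 * ln N)"
      using elim by (simp add: e_def flip: exp_of_nat_mult)
    also have "\<dots> = 1 / N ^ 2"
      using elim by (simp add: exp_minus field_simps exp_double)
    finally have "(1 - e N) ^ N / e N \<le> 1 / N ^ 2 / e N"
      using elim by (intro divide_right_mono) auto
    also have "\<dots> = 1 / (N * (2 * ln N))"
      using elim lnN by (simp add: e_def field_simps power2_eq_square)
    finally have "ret_gf (1 - e N) - 1 / (N * (2 * ln N)) \<le> (\<Sum>n\<le>N. ret n)"
      using ret_gf_le_partial_green[of "1 - e N" N] elim by simp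
    then have "(ret_gf (1 - e N) - 1 / (N * (2 * ln N))) / ln N \<le> (\<Sum>n\<le>N. ret n) / ln N"
      using lnN by (intro divide_right_mono) auto
    then show ?case by (simp add: diff_divide_distrib)
  qed
  ultimately show ?thesis by auto
qed

text \<open>Monotonicity of \<open>esc\<close> takes the place of a Tauberian theorem:
  \<open>esc_partial_green_le_1\<close> gives the upper bound and
  \<open>inverse_ret_gf_le_esc\<close> at \<open>z = 1 - e N\<close> the lower one.\<close>

theorem esc_asymp: "(\<lambda>N. esc N * ln N) \<longlonglongrightarrow> 1 / c"
proof -
  obtain l where l: "l \<longlonglongrightarrow> c" and le: "\<forall>\<^sub>F N in sequentially. l N \<le> (\<Sum>n\<le>N. ret n) / ln N"
    using partial_green_lower by blast
  \<comment> \<open>\<open>ln (1 / e N) \<sim> ln N\<close>, while the contribution \<open>e N * N\<close> of the times below \<open>N\<close> is \<open>o(1 / ln N)\<close>\<close>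
  define e where "e = (\<lambda>N::nat. 1 / (N * (ln N)\<^sup>2))"
  have up: "(\<lambda>N. 1 / l N) \<longlonglongrightarrow> 1 / c"
    using c_pos by (intro tendsto_intros l) auto
  have "(\<lambda>N. ret_gf (1 - e N) / ln N) \<longlonglongrightarrow> c"
    by (rule ret_gf_along; unfold e_def; real_asymp)
  then have "(\<lambda>N. 1 / (ret_gf (1 - e N) / ln N)) \<longlonglongrightarrow> 1 / c"
    using c_pos by (intro tendsto_intros) auto
  moreover have "(\<lambda>N::nat. e N * N * ln N) \<longlonglongrightarrow> 0"
    unfolding e_def by real_asymp
  ultimately have lo: "(\<lambda>N. 1 / (ret_gf (1 - e N) / ln N) - e N * N * ln N) \<longlonglongrightarrow> 1 / c - 0"
    by (rule tendsto_diff)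
  have ev: "\<forall>\<^sub>F N::nat in sequentially. 0 < e N" "\<forall>\<^sub>F N::nat in sequentially. e N < 1"
    "\<forall>\<^sub>F N::nat in sequentially. N > 1"
    unfolding e_def by real_asymp+
  have evl: "\<forall>\<^sub>F N in sequentially. l N > 0"
    using order_tendstoD(1)[OF l c_pos] .
  have "\<forall>\<^sub>F N in sequentially. esc N * ln N \<le> 1 / l N"
    using le evl ev(3)
  proof eventually_elim
    case (elim N)
    have lnN: "ln N > 0" using elim by simp
    have "l N * ln N \<le> (\<Sum>n\<le>N. ret n)"
      using elim lnN by (simp add: pos_le_divide_eq)
    then have "esc N * (l N * ln N) \<le> esc N * (\<Sum>n\<le>N. ret n)"
      by (intro mult_left_mono) (simp_all add: esc_bounds)
    then have "(esc N * ln N) * l N \<le> 1"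
      using esc_partial_green_le_1[of N] by (simp add: mult_ac)
    then show ?case using elim by (simp add: pos_le_divide_eq)
  qed
  moreover have "\<forall>\<^sub>F N in sequentially. 1 / (ret_gf (1 - e N) / ln N) - e N * N * ln N \<le> esc N * ln N"
    using ev
  proof eventually_elim
    case (elim N)
    have "1 / ret_gf (1 - e N) * ln N \<le> (e N * N + esc N) * ln N"
      using inverse_ret_gf_le_esc[of "1 - e N" N] elim by (intro mult_right_mono) auto
    then show ?case by (simp add: algebra_simps)
  qed
  ultimately show ?thesis
    using tendsto_sandwich[OF _ _ _ up] lo by fastforce
qed

theorem partial_green_asymp: "(\<lambda>N. (\<Sum>n\<le>N. ret n) / ln N) \<longlonglongrightarrow> c"
proof -
  obtain l where l: "l \<longlonglongrightarrow> c" and le: "\<forall>\<^sub>F N in sequentially. l N \<le> (\<Sum>n\<le>N. ret n) / ln N"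
    using partial_green_lower by blast
  have up: "(\<lambda>N. 1 / (esc N * ln N)) \<longlonglongrightarrow> 1 / (1 / c)"
    using c_pos by (intro tendsto_intros esc_asymp) auto
  have pos: "\<forall>\<^sub>F N in sequentially. esc N * ln N > 0"
    using order_tendstoD(1)[OF esc_asymp, of 0] c_pos by simp
  have "\<forall>\<^sub>F N in sequentially. (\<Sum>n\<le>N. ret n) / ln N \<le> 1 / (esc N * ln N)"
    using pos eventually_gt_at_top[of 1]
  proof eventually_elim
    case (elim N)
    have "ln N > 0" using elim by simp
    then have "esc N > 0" using elim by (simp add: zero_less_mult_iff)
    then have "(\<Sum>n\<le>N. ret n) \<le> 1 / esc N"
      using esc_partial_green_le_1[of N] by (simp add: pos_le_divide_eq mult.commute)
    then have "(\<Sum>n\<le>N. ret n) / ln N \<le> 1 / esc N / ln N"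
      using \<open>ln N > 0\<close> by (intro divide_right_mono) auto
    then show ?case by simp
  qed
  then show ?thesis
    using tendsto_sandwich[OF le _ l] up by simp
qed

lemma hits_limit:
  fixes m :: "nat \<Rightarrow> nat"
  assumes m: "(\<lambda>N. m N / ln N) \<longlonglongrightarrow> y"
  shows "(\<lambda>N. hits N (m N) a) \<longlonglongrightarrow> exp (- (y / c))"
proof (rule tendsto_sandwich)
  \<comment> \<open>short enough for \<open>L N * m N \<le> N\<close>, long enough for \<open>ln (L N) \<sim> ln N\<close>\<close>
  define L where "L = (\<lambda>N::nat. nat \<lfloor>N / (ln N)\<^sup>2\<rfloor>)"
  have L: "filterlim L at_top sequentially"
    unfolding L_def by real_asymp
  have lnL: "(\<lambda>N. ln N / ln (L N)) \<longlonglongrightarrow> 1"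
    unfolding L_def by real_asymp
  have escL: "(\<lambda>N. esc (L N) * ln (L N)) \<longlonglongrightarrow> 1 / c"
    by (rule filterlim_compose[OF esc_asymp L])
  have evL: "\<forall>\<^sub>F N in sequentially. L N > 1"
    by (rule eventually_compose_filterlim[OF eventually_gt_at_top L])
  have "(\<lambda>N. (m N / ln N) * (ln N / ln (L N)) * (esc (L N) * ln (L N))) \<longlonglongrightarrow> y * 1 * (1 / c)"
    by (intro tendsto_mult m lnL escL)
  moreover have "\<forall>\<^sub>F N in sequentially. (m N / ln N) * (ln N / ln (L N)) * (esc (L N) * ln (L N)) = m N * esc (L N)"
    using evL eventually_gt_at_top[of 1] by eventually_elim auto
  ultimately have mesc: "(\<lambda>N. m N * esc (L N)) \<longlonglongrightarrow> y / c"
    using Lim_transform_eventually by fastforce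
  have "(\<lambda>N. (esc (L N) * ln (L N)) * (1 / ln (L N))) \<longlonglongrightarrow> 1 / c * 0"
    by (intro tendsto_mult escL) (unfold L_def, real_asymp)
  moreover have "\<forall>\<^sub>F N in sequentially. (esc (L N) * ln (L N)) * (1 / ln (L N)) = esc (L N)"
    using evL by eventually_elim auto
  ultimately have esc0: "(\<lambda>N. esc (L N)) \<longlonglongrightarrow> 0"
    using Lim_transform_eventually by fastforce
  \<comment> \<open>The lower bound is \<open>exp (- u - 2 * u\<^sup>2) \<le> 1 - u\<close>, valid
    for \<open>0 \<le> u \<le> 1 / 2\<close>, at \<open>u = esc (L N)\<close> and raised to the
    power \<open>m N\<close>. The quadratic term disappears in the limit since
    \<open>m N * u\<close> converges and \<open>u\<close> tends to 0.\<close>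
  show "(\<lambda>N. exp (- (m N * esc (L N)) - 2 * (m N * esc (L N)) * esc (L N))) \<longlonglongrightarrow> exp (- (y / c))"
    using tendsto_exp[OF tendsto_diff[OF tendsto_minus[OF mesc]
        tendsto_mult[OF tendsto_mult[OF tendsto_const[of 2] mesc] esc0]]] by simp
  \<comment> \<open>Eventually \<open>m N\<close> is at most the square of \<open>ln N\<close>,
    which by the choice of \<open>L\<close> gives \<open>L N * m N \<le> N\<close>.\<close>
  have "(\<lambda>N. (m N / ln N) * (1 / ln N)) \<longlonglongrightarrow> y * 0"
    by (intro tendsto_mult m) real_asymp
  then have "\<forall>\<^sub>F N in sequentially. (m N / ln N) * (1 / ln N) < 1"
    by (rule order_tendstoD) simp
  moreover have "\<forall>\<^sub>F N in sequentially. esc (L N) < 1 / 2"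
    using order_tendstoD(2)[OF esc0, of "1 / 2"] by simp
  ultimately show "\<forall>\<^sub>F N in sequentially. exp (- (m N * esc (L N)) - 2 * (m N * esc (L N)) * esc (L N)) \<le> hits N (m N) a"
    using eventually_gt_at_top[of 1]
  proof eventually_elim
    case (elim N)
    have lnN: "ln N > 0" using elim by simp
    then have "real (m N) \<le> (ln N)\<^sup>2"
      using elim by (simp add: field_simps power2_eq_square)
    then have "real (L N) * real (m N) \<le> (N / (ln N)\<^sup>2) * (ln N)\<^sup>2"
      using lnN by (intro mult_mono) (auto simp: L_def)
    then have "real (L N * m N) \<le> real N"
      using lnN by simp
    then have "L N * m N \<le> N"
      by (simp only: of_nat_le_iff)
    then have "(1 - esc (L N)) ^ m N \<le> hits N (m N) a"
      using hits_ge_power[of "L N" "m N" N] by (simp add: esc_def)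
    moreover have "exp (- esc (L N) - 2 * (esc (L N))\<^sup>2) ^ m N \<le> (1 - esc (L N)) ^ m N"
    proof (rule power_mono)
      have "- esc (L N) - 2 * (esc (L N))\<^sup>2 \<le> ln (1 - esc (L N))"
        using elim esc_bounds by (intro ln_one_minus_pos_lower_bound) auto
      then show "exp (- esc (L N) - 2 * (esc (L N))\<^sup>2) \<le> 1 - esc (L N)"
        using elim by (simp add: ln_ge_iff)
    qed simp
    ultimately show ?case
      by (simp add: algebra_simps power2_eq_square flip: exp_of_nat_mult)
  qed
next
  have "(\<lambda>N. (m N / ln N) * (esc N * ln N)) \<longlonglongrightarrow> y * (1 / c)"
    by (intro tendsto_mult m esc_asymp)
  moreover have "\<forall>\<^sub>F N in sequentially. (m N / ln N) * (esc N * ln N) = m N * esc N"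
    using eventually_gt_at_top[of 1] by eventually_elim auto
  ultimately have "(\<lambda>N. m N * esc N) \<longlonglongrightarrow> y / c"
    using Lim_transform_eventually by fastforce
  then show "(\<lambda>N. exp (- (m N * esc N))) \<longlonglongrightarrow> exp (- (y / c))"
    by (intro tendsto_intros)
  have "hits N (m N) a \<le> exp (- (m N * esc N))" for N
  proof -
    have "hits N (m N) a \<le> (1 - esc N) ^ m N"
      using hits_le_power[of N N "m N - 1" a] by (cases "m N") (auto simp: esc_def)
    also have "\<dots> \<le> exp (- esc N) ^ m N"
      using exp_ge_add_one_self[of "- esc N"] esc_bounds[of N] by (intro power_mono) auto
    finally show ?thesis by (simp flip: exp_of_nat_mult)
  qed
  then show "\<forall>\<^sub>F N in sequentially. hits N (m N) a \<le> exp (- (m N * esc N))"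
    by simp
qed

theorem count_traj_limit:
  fixes b :: "nat \<Rightarrow> real"
  assumes b: "(\<lambda>N. b N / ln N) \<longlonglongrightarrow> c" and x: "0 \<le> x"
  shows "(\<lambda>N. measure_pmf.prob (traj N) {xs. x * b N \<le> count_list xs a}) \<longlonglongrightarrow> exp (- x)"
proof -
  \<comment> \<open>The least natural number reaching \<open>x * b N\<close>, less the visit at time
    0. If \<open>x * b N = 0\<close>, truncated subtraction gives 0, as it should.\<close>
  define m where "m = (\<lambda>N. nat \<lceil>x * b N\<rceil> - 1)"
  have "\<forall>\<^sub>F N in sequentially. b N / ln N > 0"
    using order_tendstoD(1)[OF b c_pos] .
  then have "\<forall>\<^sub>F N in sequentially. norm (m N / ln N - x * (b N / ln N)) \<le> 1 / ln N"
    using eventually_gt_at_top[of 1]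
  proof eventually_elim
    case (elim N)
    have lnN: "ln N > 0" using elim by simp
    then have "x * b N \<ge> 0" using elim x by (simp add: zero_less_divide_iff)
    then have "\<bar>m N - x * b N\<bar> \<le> 1"
      unfolding m_def by (cases "x * b N = 0") (auto simp: of_nat_diff, linarith+)
    then have "\<bar>m N - x * b N\<bar> / ln N \<le> 1 / ln N"
      using lnN by (intro divide_right_mono) auto
    also have "\<bar>m N - x * b N\<bar> / ln N = norm (m N / ln N - x * (b N / ln N))"
      using lnN by (simp add: abs_divide flip: diff_divide_distrib)
    finally show ?case .
  qed
  moreover have "(\<lambda>N::nat. 1 / ln N) \<longlonglongrightarrow> 0" by real_asymp
  ultimately have "(\<lambda>N. m N / ln N - x * (b N / ln N)) \<longlonglongrightarrow> 0"
    by (rule Lim_null_comparison)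
  from tendsto_add[OF this tendsto_mult[OF tendsto_const[of x] b]]
  have "(\<lambda>N. m N / ln N) \<longlonglongrightarrow> x * c" by simp
  from hits_limit[OF this] have "(\<lambda>N. hits N (m N) a) \<longlonglongrightarrow> exp (- x)"
    using c_pos by simp
  moreover have "measure_pmf.prob (traj N) {xs. x * b N \<le> count_list xs a} = hits N (m N) a" for N
    using prob_count_traj[of N "nat \<lceil>x * b N\<rceil>"] by (simp add: m_def nat_ceiling_le_eq)
  ultimately show ?thesis by simp
qed

end

section \<open>Laws of trajectories\<close>

text \<open>The newest state comes first, to match the lists of \<open>traj\<close>.\<close>

primrec history :: "(nat \<Rightarrow> 'a \<Rightarrow> 's) \<Rightarrow> nat \<Rightarrow> 'a \<Rightarrow> 's list" where
  "history C 0 \<omega> = [C 0 \<omega>]"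
| "history C (Suc n) \<omega> = C (Suc n) \<omega> # history C n \<omega>"

lemma history_eq_iff:
  "history C n \<omega> = xs \<longleftrightarrow> length xs = Suc n \<and> (\<forall>i\<le>n. C i \<omega> = xs ! (n - i))"
proof (induction n arbitrary: xs)
  case 0
  show ?case by (cases xs) auto
next
  case (Suc n)
  show ?case
  proof (cases xs)
    case (Cons y ys)
    have "(\<forall>i\<le>Suc n. C i \<omega> = xs ! (Suc n - i)) \<longleftrightarrow>
      C (Suc n) \<omega> = y \<and> (\<forall>i\<le>n. C i \<omega> = ys ! (n - i))"
      by (auto simp: Cons le_Suc_eq Suc_diff_le)
    then show ?thesis using Suc[of ys] Cons by auto
  qed simp
qed

lemma hd_history [simp]: "hd (history C n \<omega>) = C n \<omega>"
  by (cases n) auto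

lemma local_time_eq_count_history: "local_time C z n \<omega> = count_list (history C n \<omega>) z"
  by (induction n) (auto simp: local_time_def indicator_def)

context finite_step_chain
begin

lemma pmf_traj_Suc: "pmf (traj (Suc n)) (y # ys) = pmf (traj n) ys * pmf (\<kappa> (hd ys)) y"
proof -
  have "pmf (map_pmf (\<lambda>y. y # xs) (\<kappa> (hd xs))) (y # ys) = indicator {ys} xs * pmf (\<kappa> (hd ys)) y" for xs
  proof -
    have "(\<lambda>y. y # xs) -` {y # ys} = (if xs = ys then {y} else {})" by auto
    then show ?thesis by (auto simp: pmf_map measure_pmf_single)
  qed
  then show ?thesis
    by (simp add: pmf_bind measure_pmf_single)
qed

lemma pmf_traj_Suc_Nil: "pmf (traj (Suc n)) [] = 0"
  using traj_Nil by (auto simp: pmf_eq_0_set_pmf simp del: traj.simps)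

lemma prob_history_eq_pmf:
  assumes C: "markov_chain_from M (\<lambda>x y. pmf (\<kappa> x) y) a C"
  shows "\<P>(\<omega> in M. history C n \<omega> = xs) = pmf (traj n) xs"
proof (induction n arbitrary: xs)
  interpret prob_space M using C by (simp add: markov_chain_from_def)
  case 0
  have [measurable]: "C 0 \<in> measurable M (count_space UNIV)"
    and AE0: "AE \<omega> in M. C 0 \<omega> = a"
    using C by (auto simp: markov_chain_from_def)
  have "\<P>(\<omega> in M. [C 0 \<omega>] = xs) = \<P>(\<omega> in M. [a] = xs)"
    by (rule prob_eq_AE) (use AE0 in auto)
  also have "\<dots> = pmf (traj 0) xs"
    by (auto simp: indicator_def prob_space)
  finally show ?case by simp
next
  interpret prob_space M using C by (simp add: markov_chain_from_def)
  case (Suc n)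
  have [measurable]: "C i \<in> measurable M (count_space UNIV)" for i
    using C by (auto simp: markov_chain_from_def)
  show ?case
  proof (cases xs)
    case Nil
    then show ?thesis by (simp add: pmf_traj_Suc_Nil del: traj.simps)
  next
    case (Cons y ys)
    let ?past = "\<P>(\<omega> in M. history C n \<omega> = ys)"
    have meas: "{\<omega> \<in> space M. history C n \<omega> = ys} \<in> sets M"
      unfolding history_eq_iff by measurable
    have "\<P>(\<omega> in M. history C (Suc n) \<omega> = xs) = ?past * pmf (\<kappa> (hd ys)) y"
    proof (cases "?past = 0")
      \<comment> \<open>The Markov property says nothing about a past of probability 0, but then
        both sides vanish.\<close>
      case True
      have "\<P>(\<omega> in M. history C (Suc n) \<omega> = xs) \<le> ?past"
        by (intro finite_measure_mono meas) (auto simp: Cons)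
      then show ?thesis using True by (simp add: antisym measure_nonneg)
    next
      case False
      have len: "length ys = Suc n"
        by (rule ccontr) (use False in \<open>simp add: history_eq_iff\<close>)
      then have hist: "(\<forall>i\<le>n. C i \<omega> = ys ! (n - i)) \<longleftrightarrow> history C n \<omega> = ys" for \<omega>
        by (simp add: history_eq_iff)
      have step: "0 < \<P>(\<omega> in M. \<forall>i\<le>n. C i \<omega> = s i) \<Longrightarrow>
        \<P>(\<omega> in M. C (Suc n) \<omega> = y \<bar> \<forall>i\<le>n. C i \<omega> = s i) = pmf (\<kappa> (s n)) y" for s
        using C unfolding markov_chain_from_def by auto
      have "0 < ?past" using False by (simp add: zero_less_measure_iff)
      then have "\<P>(\<omega> in M. C (Suc n) \<omega> = y \<bar> history C n \<omega> = ys) = pmf (\<kappa> (ys ! (n - n))) y"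
        using step[of "\<lambda>i. ys ! (n - i)"] by (simp only: hist)
      moreover have "ys ! 0 = hd ys" using len by (cases ys) auto
      ultimately have "\<P>(\<omega> in M. C (Suc n) \<omega> = y \<and> history C n \<omega> = ys) = ?past * pmf (\<kappa> (hd ys)) y"
        using False by (simp add: cond_prob_def field_simps)
      then show ?thesis by (simp add: Cons)
    qed
    then show ?thesis by (simp add: Suc Cons pmf_traj_Suc del: traj.simps)
  qed
qed

text \<open>There are countably many finite paths, so their law is determined by the singletons
  treated in \<open>prob_history_eq_pmf\<close>.\<close>

theorem prob_history:
  assumes C: "markov_chain_from M (\<lambda>x y. pmf (\<kappa> x) y) a C"
  shows "\<P>(\<omega> in M. P (history C n \<omega>)) = measure_pmf.prob (traj n) {xs. P xs}"
proof -
  interpret prob_space M using C by (simp add: markov_chain_from_def)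
  have [measurable]: "C i \<in> measurable M (count_space UNIV)" for i
    using C by (auto simp: markov_chain_from_def)
  have "{\<omega> \<in> space M. history C n \<omega> = xs} \<in> sets M" for xs
    unfolding history_eq_iff by measurable
  moreover have "history C n -` {xs} \<inter> space M = {\<omega> \<in> space M. history C n \<omega> = xs}" for xs
    by auto
  ultimately have meas [measurable]: "history C n \<in> measurable M (count_space UNIV)"
    by (simp add: measurable_count_space_eq2_countable)
  have "distr M (count_space UNIV) (history C n) = measure_pmf (traj n)"
  proof (rule measure_eqI_countable[where A = UNIV])
    fix xs
    have "emeasure (distr M (count_space UNIV) (history C n)) {xs} = emeasure M {\<omega> \<in> space M. history C n \<omega> = xs}"
      by (subst emeasure_distr) (auto intro!: arg_cong[where f = "emeasure M"])
    also have "\<dots> = emeasure (measure_pmf (traj n)) {xs}"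
      using prob_history_eq_pmf[OF C, of n xs] by (simp add: emeasure_eq_measure emeasure_pmf_single)
    finally show "emeasure (distr M (count_space UNIV) (history C n)) {xs} = emeasure (measure_pmf (traj n)) {xs}" .
  qed auto
  then have "measure_pmf.prob (traj n) {xs. P xs} = measure (distr M (count_space UNIV) (history C n)) {xs. P xs}"
    by simp
  also have "\<dots> = \<P>(\<omega> in M. P (history C n \<omega>))"
    by (subst measure_distr) (auto intro!: arg_cong[where f = "measure M"])
  finally show ?thesis by simp
qed

end

section \<open>The HPHC walk\<close>

text \<open>For \<open>j < 0\<close> the horizontal probability \<open>1/2 - hphc_p j\<close> is 0,
  so in both regions the step is uniform on a finite set of neighbours.\<close>

fun hphc_step :: "int \<times> int \<Rightarrow> (int \<times> int) pmf" where
  "hphc_step (k, j) =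
     (if j \<ge> 0 then pmf_of_set {(k + 1, j), (k - 1, j), (k, j + 1), (k, j - 1)}
      else pmf_of_set {(k, j + 1), (k, j - 1)})"

lemma pmf_hphc_step: "pmf (hphc_step x) y = hphc_trans x y"
  by (cases x; cases y) (auto simp: hphc_p_def indicator_def)

lemma expectation_hphc_step:
  fixes f :: "int \<times> int \<Rightarrow> real"
  shows "measure_pmf.expectation (hphc_step (k, j)) f =
    (if j \<ge> 0 then (f (k + 1, j) + f (k - 1, j) + f (k, j + 1) + f (k, j - 1)) / 4
     else (f (k, j + 1) + f (k, j - 1)) / 2)"
  by (simp add: integral_pmf_of_set)

interpretation hphc: finite_step_chain hphc_step "(0, 0)"
proof
  show "finite (set_pmf (hphc_step x))" for x
    by (cases x) auto
qed

text \<open>Each step changes the sum of the coordinates by one, so its parity is that of the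
  time.\<close>

lemma hphc_ret_odd: "odd n \<Longrightarrow> hphc.ret n = 0"
proof -
  have parity: "xs \<in> set_pmf (hphc.traj n) \<Longrightarrow> even (fst (hd xs) + snd (hd xs)) \<longleftrightarrow> even n" for xs n
  proof (induction n arbitrary: xs)
    case (Suc n)
    then obtain ys y where ys: "ys \<in> set_pmf (hphc.traj n)" "xs = y # ys" "y \<in> set_pmf (hphc_step (hd ys))"
      by auto
    then have "even (fst y + snd y) \<longleftrightarrow> odd (fst (hd ys) + snd (hd ys))"
      by (cases "hd ys") (auto split: if_splits)
    then show ?case using Suc.IH[OF ys(1)] unfolding ys(2) list.sel even_Suc by blast
  qed simp
  assume "odd n"
  then have "set_pmf (hphc.traj n) \<inter> {xs. hd xs = (0, 0)} = {}"
    using parity[of _ n] by force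
  then show ?thesis
    by (simp add: hphc.ret_def measure_pmf_zero_iff)
qed

lemma truncated_green_eq:
  assumes "hphc_walk M C"
  shows "truncated_green M C N = (\<Sum>n\<le>N. hphc.ret n)"
proof -
  have C: "markov_chain_from M (\<lambda>x y. pmf (hphc_step x) y) (0, 0) C"
    using assms by (simp add: hphc_walk_def pmf_hphc_step)
  have "truncated_green M C N = (\<Sum>k\<le>N div 2. hphc.ret (2 * k))"
    unfolding truncated_green_def hphc.ret_def
    using hphc.prob_history[OF C, of "\<lambda>xs. hd xs = (0, 0)"] by simp
  also have "\<dots> = (\<Sum>n\<in>(*) 2 ` {..N div 2}. hphc.ret n)"
    by (subst sum.reindex) (auto simp: inj_on_def)
  also have "\<dots> = (\<Sum>n\<le>N. hphc.ret n)"
  proof (rule sum.mono_neutral_left)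
    show "\<forall>n\<in>{..N} - (*) 2 ` {..N div 2}. hphc.ret n = 0"
    proof
      fix n assume n: "n \<in> {..N} - (*) 2 ` {..N div 2}"
      have "odd n"
      proof
        assume "even n"
        then have "n = 2 * (n div 2)" "n div 2 \<in> {..N div 2}"
          using n by (auto intro: div_le_mono)
        then show False using n by blast
      qed
      then show "hphc.ret n = 0" by (rule hphc_ret_odd)
    qed
  qed auto
  finally show ?thesis .
qed

section \<open>Trigonometric identities and integrals\<close>

lemma one_minus_cos: "1 - cos t = 2 * (sin (t / 2))\<^sup>2" for t :: real
  using cos_double_sin[of "t / 2"] by simp

text \<open>In Fourier space, adding the two horizontal neighbours is multiplication by
  \<open>2 * cos t\<close>.\<close>

lemma cos_shift: "cos (of_int (k + 1) * t) + cos (of_int (k - 1) * t) = 2 * cos t * cos (of_int k * t)" for t :: real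
proof -
  have "of_int (k + 1) * t = of_int k * t + t" "of_int (k - 1) * t = of_int k * t - t"
    by (simp_all add: algebra_simps)
  then show ?thesis by (simp only: cos_add cos_diff) simp
qed

lemma has_integral_cos_int:
  "((\<lambda>t. cos (of_int k * t)) has_integral (if k = 0 then pi else 0)) {0..pi}"
proof (cases "k = 0")
  case True
  then show ?thesis using has_integral_const_real[of "1::real" 0 pi] by simp
next
  case False
  have "((\<lambda>t. cos (of_int k * t)) has_integral
      (sin (of_int k * pi) / of_int k - sin (of_int k * 0) / of_int k)) {0..pi}"
    by (rule fundamental_theorem_of_calculus)
      (use False in \<open>auto intro!: derivative_eq_intros simp flip: has_real_derivative_iff_has_vector_derivative\<close>)
  then show ?thesis
    using False by (simp add: sin_int_times_real mult.commute)
qed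

text \<open>The denominator has derivative \<open>p * cos (t / 2)\<close>, so the antiderivative is
  a logarithm; \<open>ln q\<close> will carry the singularity as \<open>q\<close> tends to
  0.\<close>

lemma has_integral_cos_half_div:
  fixes p q :: real
  assumes "0 < p" "0 < q"
  shows "((\<lambda>t. cos (t / 2) / (2 * p * sin (t / 2) + q)) has_integral ((ln (2 * p + q) - ln q) / p)) {0..pi}"
proof -
  have "((\<lambda>t. cos (t / 2) / (2 * p * sin (t / 2) + q)) has_integral
      (ln (2 * p * sin (pi / 2) + q) / p - ln (2 * p * sin (0 / 2) + q) / p)) {0..pi}"
  proof (rule fundamental_theorem_of_calculus)
    fix t :: real assume t: "t \<in> {0..pi}"
    have "0 \<le> sin (t / 2)" using t by (intro sin_ge_zero) auto
    then have "0 < 2 * p * sin (t / 2) + q" using assms by (intro add_nonneg_pos) auto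
    then have "((\<lambda>t. ln (2 * p * sin (t / 2) + q) / p) has_real_derivative
        (2 * p * (cos (t / 2) * (1 / 2))) / (2 * p * sin (t / 2) + q) / p) (at t within {0..pi})"
      by (auto intro!: derivative_eq_intros)
    then show "((\<lambda>t. ln (2 * p * sin (t / 2) + q) / p) has_vector_derivative
        cos (t / 2) / (2 * p * sin (t / 2) + q)) (at t within {0..pi})"
      using assms unfolding has_real_derivative_iff_has_vector_derivative[symmetric] by simp
  qed simp
  then show ?thesis by (simp add: diff_divide_distrib)
qed

lemma has_integral_cos_half: "((\<lambda>t. cos (t / 2)) has_integral 2) {0..pi}"
proof -
  have "((\<lambda>t. cos (t / 2)) has_integral (2 * sin (pi / 2) - 2 * sin (0 / 2))) {0..pi}"
    by (rule fundamental_theorem_of_calculus)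
      (auto intro!: derivative_eq_intros simp flip: has_real_derivative_iff_has_vector_derivative)
  then show ?thesis by simp
qed

section \<open>The Green function of the HPHC walk as a Fourier integral\<close>

locale hphc_resolvent =
  fixes z :: real
  assumes z_pos: "0 < z" and z_less_1: "z < 1"
begin

text \<open>\<open>W j t\<close> is the Fourier transform in the horizontal coordinate, at frequency \<open>t\<close>, of the
  \<open>z\<close>-Green function at height \<open>j\<close>. The bounded solutions of the recurrence in \<open>j\<close> are
  geometric, with ratio \<open>\<alpha> t\<close> above and \<open>\<beta>\<close> below the horizontal axis; \<open>diag t\<close> matches
  them at \<open>j = 0\<close>.\<close>

definition \<eta> :: real where "\<eta> = sqrt (1 - z\<^sup>2)"

text \<open>\<open>root t\<close> and \<eta> come from the discriminants of
  \<open>z * X\<^sup>2 - 2 * (2 - z * cos t) * X + z\<close> and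
  \<open>z * X\<^sup>2 - 2 * X + z\<close>, the characteristic polynomials above and below the axis.
  \<open>\<alpha> t\<close> and \<open>\<beta>\<close> are their smaller roots, which lie in the
  unit interval.\<close>

definition root :: "real \<Rightarrow> real" where
  "root t = sqrt ((2 - z * cos t)\<^sup>2 - z\<^sup>2)"

definition \<alpha> :: "real \<Rightarrow> real" where "\<alpha> t = (2 - z * cos t - root t) / z"

definition \<beta> :: real where "\<beta> = (1 - \<eta>) / z"

definition diag :: "real \<Rightarrow> real" where
  "diag t = 4 / (1 - z * cos t + root t + \<eta>)"

definition W :: "int \<Rightarrow> real \<Rightarrow> real" where
  "W j t = diag t * (if j \<ge> 0 then \<alpha> t ^ nat j else \<beta> ^ nat (- j))"

definition green :: "int \<times> int \<Rightarrow> real" where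
  "green x = integral {0..pi} (\<lambda>t. cos (of_int (fst x) * t) * W (snd x) t) / pi"

lemma z_cos: "z * cos t \<le> z" "z * cos t \<ge> - z"
  using mult_left_le[of "cos t" z] mult_left_mono[of "-1" "cos t" z] z_pos by auto

text \<open>The difference of the two sides is \<open>2 * z * (2 - z * cos t - z)\<close>. The bound
  makes the radicand nonnegative and \<open>root t\<close> large enough for
  \<open>\<alpha> t \<le> 1\<close>.\<close>

lemma radicand_ge: "(2 - z * cos t - z)\<^sup>2 \<le> (2 - z * cos t)\<^sup>2 - z\<^sup>2"
proof -
  have "0 \<le> 2 * z * (2 - z * cos t - z)"
    using z_cos[of t] z_pos z_less_1 by (intro mult_nonneg_nonneg) linarith+
  then show ?thesis by (simp add: power2_eq_square algebra_simps)
qed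

lemma root_sq: "root t * root t = (2 - z * cos t)\<^sup>2 - z\<^sup>2"
  using order_trans[OF zero_le_power2 radicand_ge[of t]] unfolding root_def by simp

lemma root_nonneg: "0 \<le> root t"
  using order_trans[OF zero_le_power2 radicand_ge[of t]] unfolding root_def by simp

lemma \<eta>_sq: "\<eta> * \<eta> = 1 - z\<^sup>2"
  using z_pos z_less_1 by (simp add: \<eta>_def power_le_one)

lemma \<eta>_pos: "0 < \<eta>"
  using z_pos z_less_1 by (simp add: \<eta>_def power_less_one_iff)

lemma den_pos: "0 < 1 - z * cos t + root t + \<eta>"
  using z_cos[of t] z_less_1 root_nonneg[of t] \<eta>_pos by linarith

lemma \<alpha>_bounds: "0 \<le> \<alpha> t" "\<alpha> t \<le> 1"
proof -
  have "root t \<le> sqrt ((2 - z * cos t)\<^sup>2)"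
    unfolding root_def by (intro real_sqrt_le_mono) simp
  then show "0 \<le> \<alpha> t"
    using z_cos[of t] z_pos z_less_1 by (simp add: \<alpha>_def)
  have "sqrt ((2 - z * cos t - z)\<^sup>2) \<le> root t"
    unfolding root_def by (intro real_sqrt_le_mono radicand_ge)
  then show "\<alpha> t \<le> 1"
    using z_cos[of t] z_pos z_less_1 by (simp add: \<alpha>_def)
qed

lemma \<beta>_bounds: "0 \<le> \<beta>" "\<beta> \<le> 1"
proof -
  have "\<eta> \<le> 1" using z_pos by (simp add: \<eta>_def)
  then show "0 \<le> \<beta>" using z_pos by (simp add: \<beta>_def)
  have "(1 - z)\<^sup>2 \<le> 1 - z\<^sup>2"
    using z_pos z_less_1 by (simp add: power2_eq_square algebra_simps mult_left_le)
  then have "sqrt ((1 - z)\<^sup>2) \<le> \<eta>"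
    unfolding \<eta>_def by (rule real_sqrt_le_mono)
  then show "\<beta> \<le> 1" using z_pos z_less_1 by (simp add: \<beta>_def)
qed

lemma diag_bounds: "0 \<le> diag t" "diag t \<le> 4 / \<eta>"
proof -
  show "0 \<le> diag t" using den_pos[of t] by (simp add: diag_def)
  have "\<eta> \<le> 1 - z * cos t + root t + \<eta>"
    using z_cos[of t] z_less_1 root_nonneg[of t] by linarith
  then show "diag t \<le> 4 / \<eta>"
    unfolding diag_def using \<eta>_pos by (intro divide_left_mono mult_pos_pos den_pos) auto
qed

lemma W_bound: "\<bar>W j t\<bar> \<le> 4 / \<eta>"
proof -
  have p: "0 \<le> (if j \<ge> 0 then \<alpha> t ^ nat j else \<beta> ^ nat (- j))"
    "(if j \<ge> 0 then \<alpha> t ^ nat j else \<beta> ^ nat (- j)) \<le> 1"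
    using \<alpha>_bounds[of t] \<beta>_bounds by (auto intro: power_le_one)
  have "W j t \<le> diag t * 1"
    unfolding W_def by (intro mult_left_mono p diag_bounds)
  moreover have "0 \<le> W j t"
    unfolding W_def by (intro mult_nonneg_nonneg p diag_bounds)
  ultimately show ?thesis using diag_bounds(2)[of t] by simp
qed

lemma continuous_root [continuous_intros]: "continuous_on A root"
  unfolding root_def by (intro continuous_intros)

lemma continuous_diag [continuous_intros]: "continuous_on A diag"
proof -
  have "1 - z * cos t + root t + \<eta> \<noteq> 0" for t
    using den_pos[of t] by simp
  then show ?thesis
    unfolding diag_def by (intro continuous_intros) auto
qed

lemma continuous_W [continuous_intros]: "continuous_on A (W j)"
proof -
  have "continuous_on A \<alpha>"
    unfolding \<alpha>_def by (intro continuous_intros) (use z_pos in auto)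
  then show ?thesis
    unfolding W_def by (cases "j \<ge> 0") (auto intro!: continuous_intros)
qed

lemma integrable_cos_W: "(\<lambda>t. cos (of_int k * t) * W j t) integrable_on {0..pi}"
  by (intro integrable_continuous_interval continuous_intros)

lemma \<alpha>_quadratic: "\<alpha> t = z * (cos t / 2 * \<alpha> t + (\<alpha> t)\<^sup>2 / 4 + 1 / 4)"
proof -
  have "z * (cos t / 2 * \<alpha> t + (\<alpha> t)\<^sup>2 / 4 + 1 / 4) - \<alpha> t =
    ((z * \<alpha> t) * (z * \<alpha> t) + z\<^sup>2 - 2 * (2 - z * cos t) * (z * \<alpha> t)) / (4 * z)"
    using z_pos by (simp add: field_simps power2_eq_square)
  also have "z * \<alpha> t = 2 - z * cos t - root t"
    using z_pos by (simp add: \<alpha>_def)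
  also have "(2 - z * cos t - root t) * (2 - z * cos t - root t) + z\<^sup>2 -
      2 * (2 - z * cos t) * (2 - z * cos t - root t) = root t * root t + z\<^sup>2 - (2 - z * cos t)\<^sup>2"
    by (simp add: power2_eq_square algebra_simps)
  also have "\<dots> = 0" by (simp add: root_sq)
  finally show ?thesis by simp
qed

lemma \<beta>_quadratic: "\<beta> = z * (1 + \<beta>\<^sup>2) / 2"
proof -
  have "z * (1 + \<beta>\<^sup>2) / 2 - \<beta> = (z\<^sup>2 + (z * \<beta>) * (z * \<beta>) - 2 * (z * \<beta>)) / (2 * z)"
    using z_pos by (simp add: field_simps power2_eq_square)
  also have "z * \<beta> = 1 - \<eta>"
    using z_pos by (simp add: \<beta>_def)
  also have "z\<^sup>2 + (1 - \<eta>) * (1 - \<eta>) - 2 * (1 - \<eta>) = z\<^sup>2 - 1 + \<eta> * \<eta>"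
    by (simp add: algebra_simps)
  also have "\<dots> = 0" by (simp add: \<eta>_sq)
  finally show ?thesis by simp
qed

text \<open>The recurrence at height 0, where the values above and below are
  \<open>diag t * \<alpha> t\<close> and \<open>diag t * \<beta>\<close>; the summand 1 is the
  transform of the unit mass at the origin.\<close>

lemma diag_eq: "diag t = 1 + z * diag t * (cos t / 2 + \<alpha> t / 4 + \<beta> / 4)"
proof -
  have "1 - z * (cos t / 2 + \<alpha> t / 4 + \<beta> / 4) = (1 - z * cos t + root t + \<eta>) / 4"
    using z_pos by (simp add: \<alpha>_def \<beta>_def field_simps)
  then have "diag t * (1 - z * (cos t / 2 + \<alpha> t / 4 + \<beta> / 4)) = 1"
    using den_pos[of t] by (simp add: diag_def)
  then show ?thesis by (simp add: algebra_simps)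
qed

lemma W_eq_upper:
  assumes "j \<ge> 0"
  shows "W j t = of_bool (j = 0) + z * (cos t / 2 * W j t + (W (j + 1) t + W (j - 1) t) / 4)"
proof (cases "j = 0")
  case True
  then show ?thesis
    using diag_eq[of t] by (simp add: W_def algebra_simps add_divide_distrib)
next
  case False
  define n where "n = nat (j - 1)"
  have n: "nat j = Suc n" "nat (j + 1) = Suc (Suc n)" "nat (j - 1) = n"
    using assms False by (auto simp: n_def)
  have "W j t = diag t * \<alpha> t ^ n * \<alpha> t"
    using assms by (simp add: W_def n)
  also have "\<dots> = diag t * \<alpha> t ^ n * (z * (cos t / 2 * \<alpha> t + (\<alpha> t)\<^sup>2 / 4 + 1 / 4))"
    using \<alpha>_quadratic[of t] by simp
  also have "\<dots> = z * (cos t / 2 * W j t + (W (j + 1) t + W (j - 1) t) / 4)"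
    using assms False unfolding W_def n by (simp add: power2_eq_square algebra_simps)
  finally show ?thesis using False by simp
qed

lemma W_eq_lower:
  assumes "j < 0"
  shows "W j t = z * ((W (j + 1) t + W (j - 1) t) / 2)"
proof -
  define n where "n = nat (- j - 1)"
  have n: "nat (- j) = Suc n" "nat (- (j - 1)) = Suc (Suc n)" "nat (- (j + 1)) = n" "j = - 1 - int n"
    using assms by (auto simp: n_def)
  \<comment> \<open>For \<open>j = - 1\<close> the upper neighbour lies on the axis and so falls
    under the other branch of \<open>W\<close>; both branches agree at exponent 0.\<close>
  have W1: "W (j + 1) t = diag t * \<beta> ^ n"
  proof (cases "n = 0")
    case True
    then have "j + 1 = 0" using n(4) by simp
    then show ?thesis using True by (simp add: W_def)
  next
    case False
    then have "\<not> j + 1 \<ge> 0" using n(4) by simp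
    then show ?thesis unfolding W_def n(3) by simp
  qed
  have "W j t = diag t * \<beta> ^ n * \<beta>"
    using assms by (simp add: W_def n(1))
  also have "\<dots> = diag t * \<beta> ^ n * (z * (1 + \<beta>\<^sup>2) / 2)"
    using \<beta>_quadratic by simp
  also have "\<dots> = z * ((W (j + 1) t + W (j - 1) t) / 2)"
    using assms unfolding W1 unfolding W_def n(2) by (simp add: power2_eq_square algebra_simps)
  finally show ?thesis .
qed

lemma green_int: "green (k, j) = integral {0..pi} (\<lambda>t. cos (of_int k * t) * W j t) / pi"
  by (simp add: green_def)

lemma green_has_integral:
  "((\<lambda>t. cos (of_int k * t) * W j t) has_integral (pi * green (k, j))) {0..pi}"
  using integrable_integral[OF integrable_cos_W[of k j]] by (simp add: green_int)

text \<open>Integrate the recurrence for \<open>W\<close> against \<open>cos (of_int k * t)\<close>: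
  the factor \<open>cos t\<close> turns into the horizontal neighbours, and the source term survives
  only for \<open>k = 0\<close>.\<close>

lemma green_equation:
  "green x = of_bool (x = (0, 0)) + z * measure_pmf.expectation (hphc_step x) green"
proof -
  obtain k j where x: "x = (k, j)" by (cases x)
  show ?thesis
  proof (cases "j \<ge> 0")
    case True
    let ?S = "green (k + 1, j) + green (k - 1, j) + green (k, j + 1) + green (k, j - 1)"
    let ?f = "\<lambda>k j t. cos (of_int k * t) * W j t"
    have "((\<lambda>t. of_bool (j = 0) * cos (of_int k * t) +
        z / 4 * (?f (k + 1) j t + ?f (k - 1) j t + ?f k (j + 1) t + ?f k (j - 1) t)) has_integral
        (of_bool (j = 0) * (if k = 0 then pi else 0) + z / 4 *
        (pi * green (k + 1, j) + pi * green (k - 1, j) + pi * green (k, j + 1) + pi * green (k, j - 1)))) {0..pi}"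
      by (intro has_integral_add has_integral_mult_right green_has_integral has_integral_cos_int)
    moreover have "of_bool (j = 0) * cos (of_int k * t) +
        z / 4 * (?f (k + 1) j t + ?f (k - 1) j t + ?f k (j + 1) t + ?f k (j - 1) t) = ?f k j t" for t
    proof -
      have "?f (k + 1) j t + ?f (k - 1) j t = 2 * cos t * ?f k j t"
        unfolding distrib_right[symmetric] cos_shift by simp
      then have "of_bool (j = 0) * cos (of_int k * t) +
          z / 4 * (?f (k + 1) j t + ?f (k - 1) j t + ?f k (j + 1) t + ?f k (j - 1) t) =
        cos (of_int k * t) * (of_bool (j = 0) + z * (cos t / 2 * W j t + (W (j + 1) t + W (j - 1) t) / 4))"
        by (simp add: algebra_simps)
      then show ?thesis using W_eq_upper[OF True, of t] by simp
    qed
    ultimately have "pi * green (k, j) = of_bool (j = 0) * (if k = 0 then pi else 0) + z / 4 *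
        (pi * green (k + 1, j) + pi * green (k - 1, j) + pi * green (k, j + 1) + pi * green (k, j - 1))"
      using green_has_integral[of k j] by (simp add: has_integral_unique)
    also have "\<dots> = pi * (of_bool (k = 0 \<and> j = 0) + z * (?S / 4))"
      by (simp add: algebra_simps)
    finally show ?thesis
      using True unfolding x expectation_hphc_step by simp
  next
    case False
    let ?f = "\<lambda>k j t. cos (of_int k * t) * W j t"
    have "((\<lambda>t. z / 2 * (?f k (j + 1) t + ?f k (j - 1) t)) has_integral
        (z / 2 * (pi * green (k, j + 1) + pi * green (k, j - 1)))) {0..pi}"
      by (intro has_integral_add has_integral_mult_right green_has_integral)
    moreover have "z / 2 * (?f k (j + 1) t + ?f k (j - 1) t) = ?f k j t" for t
    proof -
      have "z / 2 * (?f k (j + 1) t + ?f k (j - 1) t) = cos (of_int k * t) * (z * ((W (j + 1) t + W (j - 1) t) / 2))"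
        by (simp add: algebra_simps)
      also have "z * ((W (j + 1) t + W (j - 1) t) / 2) = W j t"
        by (rule W_eq_lower[symmetric]) (use False in simp)
      finally show ?thesis .
    qed
    ultimately have "(?f k j has_integral (z / 2 * (pi * green (k, j + 1) + pi * green (k, j - 1)))) {0..pi}"
      by (simp only:)
    then have "pi * green (k, j) = z / 2 * (pi * green (k, j + 1) + pi * green (k, j - 1))"
      by (rule has_integral_unique[OF green_has_integral])
    also have "\<dots> = pi * (z * ((green (k, j + 1) + green (k, j - 1)) / 2))"
      by (simp add: algebra_simps)
    finally show ?thesis
      using False unfolding x expectation_hphc_step by simp
  qed
qed

lemma green_bound: "\<bar>green x\<bar> \<le> 4 / \<eta>"
proof -
  have "norm (integral {0..pi} (\<lambda>t. cos (of_int (fst x) * t) * W (snd x) t)) \<le> (4 / \<eta>) * (pi - 0)"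
  proof (rule integral_bound)
    show "norm (cos (of_int (fst x) * t) * W (snd x) t) \<le> 4 / \<eta>" for t :: real
      using mult_mono[OF abs_cos_le_one[of "of_int (fst x) * t"] W_bound[of "snd x" t]] by (simp add: abs_mult)
  qed (auto intro!: continuous_intros)
  then show ?thesis
    by (simp add: green_def abs_divide pos_divide_le_eq)
qed

lemma ret_gf_eq: "hphc.ret_gf z = integral {0..pi} diag / pi"
proof -
  have "(\<lambda>n. hphc.ret n * z ^ n) sums green (0, 0)"
    by (rule hphc.green_sums[OF green_equation green_bound]) (use z_pos z_less_1 in auto)
  then show ?thesis
    by (simp add: hphc.ret_gf_def sums_iff green_def W_def)
qed

section \<open>Two-sided bounds for the Green function at the origin\<close>

text \<open>Difference of squares, each factor being expressed through \<open>1 - cos t\<close>.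
  Only the first factor degenerates, as \<open>z\<close> tends to 1 and \<open>t\<close> to
  0.\<close>

lemma radicand_eq: "(2 - z * cos t)\<^sup>2 - z\<^sup>2 = 4 * ((1 - z) + z * (sin (t / 2))\<^sup>2) * (1 + z * (sin (t / 2))\<^sup>2)"
proof -
  have "z * cos t = z - z * (1 - cos t)" by (simp add: algebra_simps)
  then have zc: "z * cos t = z - 2 * (z * (sin (t / 2))\<^sup>2)"
    unfolding one_minus_cos by simp
  show ?thesis unfolding zc by (simp add: power2_eq_square algebra_simps)
qed

lemma half_angle:
  assumes "t \<in> {0..pi}"
  shows "0 \<le> sin (t / 2)" "sin (t / 2) \<le> 1" "0 \<le> cos (t / 2)" "cos (t / 2) \<le> 1"
    "1 - cos (t / 2) \<le> sin (t / 2)"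
proof -
  show s: "0 \<le> sin (t / 2)" using assms by (intro sin_ge_zero) auto
  show c: "0 \<le> cos (t / 2)" using assms by (intro cos_ge_zero) auto
  have "(1 - cos (t / 2))\<^sup>2 \<le> (sin (t / 2))\<^sup>2"
    using c mult_left_le[of "cos (t / 2)" "cos (t / 2)"]
    unfolding sin_squared_eq by (simp add: power2_eq_square algebra_simps)
  then show "1 - cos (t / 2) \<le> sin (t / 2)" using s by (rule power2_le_imp_le)
qed auto

text \<open>Bound the denominator below by \<open>?A\<close>, then write the numerator 1 as
  \<open>cos (t / 2)\<close> plus a rest of at most \<open>sin (t / 2)\<close>: the first part has
  an explicit integral, the second contributes a bounded term.\<close>

lemma diag_le:
  assumes t: "t \<in> {0..pi}"
  shows "diag t \<le> 4 * (cos (t / 2) / (2 * sqrt z * sin (t / 2) + \<eta>) + 1 / (2 * sqrt z))"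
proof -
  note h = half_angle[OF t]
  let ?A = "2 * sqrt z * sin (t / 2) + \<eta>"
  have "z * (sin (t / 2))\<^sup>2 * 1 \<le> ((1 - z) + z * (sin (t / 2))\<^sup>2) * (1 + z * (sin (t / 2))\<^sup>2)"
    using z_pos z_less_1 by (intro mult_mono) auto
  moreover have "(2 * sqrt z * sin (t / 2))\<^sup>2 = 4 * (z * (sin (t / 2))\<^sup>2 * 1)"
    using z_pos by (simp add: power_mult_distrib)
  ultimately have "2 * sqrt z * sin (t / 2) \<le> root t"
    unfolding root_def radicand_eq by (intro real_le_rsqrt) linarith
  then have le: "?A \<le> 1 - z * cos t + root t + \<eta>"
    using z_cos[of t] z_less_1 by simp
  have A: "0 < ?A" using h(1) z_pos \<eta>_pos by (intro add_nonneg_pos mult_nonneg_nonneg) simp_all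
  have "(1 - cos (t / 2)) / ?A \<le> sin (t / 2) / ?A"
    using h A by (intro divide_right_mono) auto
  also have "\<dots> \<le> 1 / (2 * sqrt z)"
    using A z_pos \<eta>_pos by (simp add: field_simps)
  finally have "1 / ?A \<le> cos (t / 2) / ?A + 1 / (2 * sqrt z)"
    by (simp add: diff_divide_distrib)
  moreover have "diag t \<le> 4 / ?A"
    unfolding diag_def using A by (intro divide_left_mono le mult_pos_pos den_pos) auto
  ultimately show ?thesis by simp
qed

text \<open>Bound the denominator above by \<open>?A + 4 * u\<^sup>2\<close>; dropping the quadratic
  term costs at most 1. The factor \<open>cos (t / 2)\<close>, which lies between 0 and 1, then
  makes the bound explicitly integrable.\<close>

lemma diag_ge:
  assumes t: "t \<in> {0..pi}"
  shows "4 * (cos (t / 2) / (2 * sin (t / 2) + 7 * sqrt (1 - z)) - cos (t / 2)) \<le> diag t"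
proof -
  note h = half_angle[OF t]
  define u where "u = sin (t / 2)"
  define e where "e = sqrt (1 - z)"
  have u: "0 \<le> u" "u \<le> 1" using h(1,2) by (simp_all add: u_def)
  have e: "0 < e" "e \<le> 1" "e * e = 1 - z" using z_pos z_less_1 by (auto simp: e_def)
  let ?A = "2 * u + 7 * e"
  have A: "0 < ?A" using u e by simp
  have zu: "z * u\<^sup>2 \<le> u\<^sup>2" using z_pos z_less_1 by (intro mult_left_le_one_le) auto
  have "e\<^sup>2 + u\<^sup>2 \<le> (e + u)\<^sup>2" "1 + u\<^sup>2 \<le> (1 + u)\<^sup>2"
    using u e by (auto simp: power2_eq_square algebra_simps)
  then have "((1 - z) + z * u\<^sup>2) * (1 + z * u\<^sup>2) \<le> (e + u)\<^sup>2 * (1 + u)\<^sup>2"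
    using zu e z_pos by (intro mult_mono) (auto simp: power2_eq_square)
  moreover have "(2 * ((e + u) * (1 + u)))\<^sup>2 = 4 * ((e + u)\<^sup>2 * (1 + u)\<^sup>2)"
    by (simp add: power_mult_distrib)
  ultimately have "4 * ((1 - z) + z * u\<^sup>2) * (1 + z * u\<^sup>2) \<le> (2 * ((e + u) * (1 + u)))\<^sup>2"
    by linarith
  then have "root t \<le> 2 * ((e + u) * (1 + u))"
    unfolding root_def radicand_eq u_def[symmetric] using u e by (intro real_le_lsqrt) auto
  also have "\<dots> = 2 * u + 2 * u\<^sup>2 + 2 * e + 2 * (e * u)"
    by (simp add: algebra_simps power2_eq_square)
  also have "e * u \<le> e" using u e by (simp add: mult_left_le)
  finally have root: "root t \<le> 2 * u + 2 * u\<^sup>2 + 4 * e" by simp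
  have "1 - z\<^sup>2 \<le> (2 * e)\<^sup>2"
  proof -
    have "1 - z\<^sup>2 = (1 - z) * (1 + z)" by (simp add: power2_eq_square algebra_simps)
    also have "\<dots> \<le> (1 - z) * 4" using z_less_1 by (intro mult_left_mono) auto
    finally show ?thesis using e by (simp add: power2_eq_square)
  qed
  then have eta: "\<eta> \<le> 2 * e"
    unfolding \<eta>_def using e by (intro real_le_lsqrt) auto
  have "1 - z * cos t = (1 - z) + z * (2 * u\<^sup>2)"
    unfolding u_def one_minus_cos[symmetric] by (simp add: algebra_simps)
  also have "\<dots> \<le> e + 2 * u\<^sup>2"
    using zu e mult_left_le[of e e] by simp
  \<comment> \<open>The coefficient 7 of \<open>e\<close> collects 4 from \<open>root t\<close>, 2
    from \<eta> and 1 from \<open>1 - z * cos t\<close>.\<close>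
  finally have den: "1 - z * cos t + root t + \<eta> \<le> ?A + 4 * u\<^sup>2"
    using root eta by simp
  \<comment> \<open>The difference is \<open>4 * u\<^sup>2 / (?A * (?A + 4 * u\<^sup>2))\<close>,
    and \<open>?A\<close> is at least \<open>2 * u\<close>.\<close>
  have "1 / ?A - 1 / (?A + 4 * u\<^sup>2) \<le> 1"
  proof -
    have "4 * u\<^sup>2 \<le> ?A * ?A"
      using u e mult_mono[of "2 * u" ?A "2 * u" ?A] by (simp add: power2_eq_square)
    also have "\<dots> \<le> ?A * (?A + 4 * u\<^sup>2)"
      using A by (intro mult_left_mono) auto
    finally show ?thesis
      using A add_pos_nonneg[OF A, of "4 * u\<^sup>2"] by (simp add: diff_frac_eq)
  qed
  moreover have "1 / (?A + 4 * u\<^sup>2) \<le> diag t / 4"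
  proof -
    have "diag t = 4 * (1 / (1 - z * cos t + root t + \<eta>))"
      by (simp add: diag_def)
    then show ?thesis
      using frac_le[OF zero_le_one order_refl den_pos den] by linarith
  qed
  ultimately have "1 / ?A - 1 \<le> diag t / 4" by linarith
  then have "cos (t / 2) * (1 / ?A - 1) \<le> cos (t / 2) * (diag t / 4)"
    using h by (intro mult_left_mono)
  also have "\<dots> \<le> diag t / 4"
    using h diag_bounds by (intro mult_left_le_one_le) auto
  finally show ?thesis by (simp add: u_def e_def algebra_simps)
qed

lemma integral_diag_le:
  "integral {0..pi} diag \<le> 4 * ((ln (2 * sqrt z + \<eta>) - ln \<eta>) / sqrt z + pi / (2 * sqrt z))"
proof -
  have const: "((\<lambda>_. 1 / (2 * sqrt z)) has_integral pi / (2 * sqrt z)) {0..pi}"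
    using has_integral_const_real[of "1 / (2 * sqrt z)" 0 pi] by simp
  have "((\<lambda>t. 4 * (cos (t / 2) / (2 * sqrt z * sin (t / 2) + \<eta>) + 1 / (2 * sqrt z))) has_integral
      4 * ((ln (2 * sqrt z + \<eta>) - ln \<eta>) / sqrt z + pi / (2 * sqrt z))) {0..pi}"
    by (intro has_integral_mult_right has_integral_add has_integral_cos_half_div const)
      (use z_pos \<eta>_pos in auto)
  from has_integral_le[OF integrable_integral this diag_le] show ?thesis
    by (simp add: integrable_continuous_interval continuous_diag)
qed

lemma integral_diag_ge:
  "4 * (ln (2 + 7 * sqrt (1 - z)) - ln (7 * sqrt (1 - z)) - 2) \<le> integral {0..pi} diag"
proof -
  have "((\<lambda>t. 4 * (cos (t / 2) / (2 * 1 * sin (t / 2) + 7 * sqrt (1 - z)) - cos (t / 2))) has_integral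
      4 * ((ln (2 * 1 + 7 * sqrt (1 - z)) - ln (7 * sqrt (1 - z))) / 1 - 2)) {0..pi}"
    by (intro has_integral_mult_right has_integral_diff has_integral_cos_half_div has_integral_cos_half)
      (use z_less_1 in auto)
  from has_integral_le[OF this integrable_integral] show ?thesis
    using diag_ge by (simp add: integrable_continuous_interval continuous_diag)
qed

end

section \<open>The logarithmic constant and the limit theorem\<close>

interpretation hphc: log_green_chain hphc_step "(0, 0)" "2 / pi"
proof
  \<comment> \<open>In both bounds the singular logarithm has an argument of order
    \<open>sqrt e\<close>, hence contributes half of \<open>ln (1 / e)\<close>; the prefactor
    \<open>4 / pi\<close> turns this into \<open>2 / pi\<close>.\<close>
  define lo where "lo = (\<lambda>e::real. 4 * (ln (2 + 7 * sqrt e) - ln (7 * sqrt e) - 2) / pi / ln (1 / e))"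
  define hi where "hi = (\<lambda>e::real. 4 * ((ln (2 * sqrt (1 - e) + sqrt (1 - (1 - e)\<^sup>2)) - ln (sqrt (1 - (1 - e)\<^sup>2)))
      / sqrt (1 - e) + pi / (2 * sqrt (1 - e))) / pi / ln (1 / e))"
  have ev: "\<forall>\<^sub>F e in at_right (0::real). 0 < e \<and> e < 1"
    by (auto simp: eventually_at_right_field intro: exI[of _ 1])
  have bounds: "lo e \<le> hphc.ret_gf (1 - e) / ln (1 / e) \<and> hphc.ret_gf (1 - e) / ln (1 / e) \<le> hi e"
    if e: "0 < e \<and> e < 1" for e
  proof -
    interpret hphc_resolvent "1 - e" using e by unfold_locales auto
    have "ln (1 / e) > 0" using e by simp
    then show ?thesis
      unfolding lo_def hi_def ret_gf_eq using integral_diag_le integral_diag_ge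
      by (intro conjI divide_right_mono) (auto simp: \<eta>_def)
  qed
  show "((\<lambda>e. hphc.ret_gf (1 - e) / ln (1 / e)) \<longlongrightarrow> 2 / pi) (at_right 0)"
  proof (rule tendsto_sandwich)
    show "\<forall>\<^sub>F e in at_right 0. lo e \<le> hphc.ret_gf (1 - e) / ln (1 / e)"
      using ev by eventually_elim (use bounds in auto)
    show "\<forall>\<^sub>F e in at_right 0. hphc.ret_gf (1 - e) / ln (1 / e) \<le> hi e"
      using ev by eventually_elim (use bounds in auto)
    have "(lo \<longlongrightarrow> 2 * inverse pi) (at_right 0)"
      unfolding lo_def by real_asymp
    then show "(lo \<longlongrightarrow> 2 / pi) (at_right 0)"
      by (simp add: divide_inverse)
    have "(hi \<longlongrightarrow> 2 * inverse pi) (at_right 0)"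
      unfolding hi_def by real_asymp
    then show "(hi \<longlongrightarrow> 2 / pi) (at_right 0)"
      by (simp add: divide_inverse)
  qed
qed simp

theorem corollary4p2:
  fixes M :: "'a measure" and C :: "nat \<Rightarrow> 'a \<Rightarrow> int \<times> int" and x :: real
  assumes "hphc_walk M C" and "x \<ge> 0"
  shows "((\<lambda>N. \<P>(\<omega> in M. local_time C (0, 0) N \<omega> / truncated_green M C N \<ge> x)) \<longlonglongrightarrow> exp (- x)) \<and>
    ((\<lambda>N. \<P>(\<omega> in M. pi * local_time C (0, 0) N \<omega> / (2 * ln (real N)) \<ge> x)) \<longlonglongrightarrow> exp (- x))"
proof
  have C: "markov_chain_from M (\<lambda>x y. pmf (hphc_step x) y) (0, 0) C"
    using assms by (simp add: hphc_walk_def pmf_hphc_step)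
  \<comment> \<open>One limit serves both normalisations: any \<open>b\<close> asymptotic to
    \<open>2 / pi * ln N\<close> is admissible.\<close>
  have lim: "(\<lambda>N. \<P>(\<omega> in M. x * b N \<le> local_time C (0, 0) N \<omega>)) \<longlonglongrightarrow> exp (- x)"
    if "(\<lambda>N. b N / ln N) \<longlonglongrightarrow> 2 / pi" for b :: "nat \<Rightarrow> real"
    using hphc.count_traj_limit[OF that assms(2)]
      hphc.prob_history[OF C, of "\<lambda>xs. x * b N \<le> count_list xs (0, 0)" N for N]
    by (simp add: local_time_eq_count_history)
  have g_pos: "truncated_green M C N > 0" for N
  proof -
    have "(\<Sum>n\<in>{0}. hphc.ret n) \<le> (\<Sum>n\<le>N. hphc.ret n)"
      by (intro sum_mono2) (auto simp: hphc.ret_bounds)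
    then show ?thesis
      by (simp add: truncated_green_eq[OF assms(1)] hphc.ret_0)
  qed
  show "(\<lambda>N. \<P>(\<omega> in M. local_time C (0, 0) N \<omega> / truncated_green M C N \<ge> x)) \<longlonglongrightarrow> exp (- x)"
    using lim[of "truncated_green M C"] hphc.partial_green_asymp
    by (simp add: pos_le_divide_eq[OF g_pos] flip: truncated_green_eq[OF assms(1)])
  have "\<forall>\<^sub>F N::nat in sequentially. 2 / pi = (2 / pi * ln N) / ln N"
    using eventually_gt_at_top[of 1] by eventually_elim simp
  then have "(\<lambda>N::nat. (2 / pi * ln N) / ln N) \<longlonglongrightarrow> 2 / pi"
    by (rule Lim_transform_eventually[OF tendsto_const])
  from lim[OF this]
  have "(\<lambda>N. \<P>(\<omega> in M. x * (2 / pi * ln N) \<le> local_time C (0, 0) N \<omega>)) \<longlonglongrightarrow> exp (- x)" .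
  \<comment> \<open>Clearing the denominator requires \<open>ln N > 0\<close>, so the events agree
    only from \<open>N = 2\<close> on.\<close>
  moreover have "\<forall>\<^sub>F N in sequentially. \<P>(\<omega> in M. x * (2 / pi * ln N) \<le> local_time C (0, 0) N \<omega>) =
      \<P>(\<omega> in M. pi * local_time C (0, 0) N \<omega> / (2 * ln (real N)) \<ge> x)"
    using eventually_gt_at_top[of 1]
  proof eventually_elim
    case (elim N)
    have "x * (2 / pi * ln N) \<le> l \<longleftrightarrow> x \<le> pi * l / (2 * ln N)" for l
      using elim by (simp add: field_simps)
    then show ?case by simp
  qed
  ultimately show "(\<lambda>N. \<P>(\<omega> in M. pi * local_time C (0, 0) N \<omega> / (2 * ln (real N)) \<ge> x)) \<longlonglongrightarrow> exp (- x)"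
    by (rule Lim_transform_eventually)
qed

end
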